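(* Let $G$ be a group with finite symmetric generating set $X$, hyperbolic relative to a collection of subgroups $\mathcal{H}=\{H_i\}_{i=1}^m$, and let $Q$ be a $\sigma$-quasiconvex subgroup of $G$. Then any infinite maximal parabolic subgroup of $Q$ is conjugate by an element of $Q$ to a subgroup in the set $$\{\,Q\cap H^z : H\in\mathcal{H}\text{ and } z\in G\text{ with }|z|_X\leq\sigma\,\},$$ where $H^z=zHz^{-1}$. In particular, the number of infinite maximal parabolic subgroups of $Q$ up to conjugacy in $Q$ is finite.
   Context: Setting. $G$ is a group, $X$ a finite generating set of $G$ closed under inverses, $\mathcal{H}=\{H_i\}_{i=1}^m$ a finite collection of subgroups. $|g|_X$ is the word length and $dist_X(f,g)=|f^{-1}g|_X$. Let $\widetilde{\mathcal{H}}=\bigsqcup_{i=1}^m(\widetilde{H_i}\setminus\{1\})$, where $\widetilde{H_i}$ is a copy of $H_i$, and let $\Gamma=Cayley(G,X\cup\widetilde{\mathcal{H}})$ be the graph with vertex set $G$ and, for each $g\in G$ and each letter $a\in X\sqcup\widetilde{\mathcal{H}}$, an edge from $g$ to $ga$ with label $a$; all edges have length 1. For a path $p$, $p_-$ and $p_+$ are its initial and terminal vertices and $l(p)$ its length. A path $p$ is a $(\lambda,c)$-quasi-geodesic if $l(q)\leq\lambda d(q_-,q_+)+c$ for every subpath $q$ of $p$, $d$ being the metric of $\Gamma$. Components. An $H_i$-component of a path $q$ in $\Gamma$ is a maximal subpath with at least one edge whose label is a word in the alphabet $\widetilde{H_i}\setminus\{1\}$; an $\mathcal{H}$-component is an $H_i$-component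 for some $i$. Two $\mathcal{H}$-components (of one path or of two paths) are connected if, for some $i$, both are $H_i$-components and their vertices belong to the same left coset of $H_i$. An $\mathcal{H}$-component of $q$ is isolated if it is not connected to a different $\mathcal{H}$-component of $q$. A path is without backtracking if all its $\mathcal{H}$-components are isolated. A vertex of $q$ is phase if it is not an inner vertex of an $\mathcal{H}$-component of $q$. Two paths $p,q$ are $k$-similar if $\max\{dist_X(p_-,q_-),dist_X(p_+,q_+)\}\leq k$. Bounded coset penetration (BCP). $(G,\mathcal{H})$ satisfies BCP if for all $\lambda\geq1$, $c\geq0$, $k\geq0$ there is an integer $\epsilon(\lambda,c,k)>0$ such that for any two $k$-similar $(\lambda,c)$-quasi-geodesics $p,q$ in $\Gamma$ without backtracking: (i) the sets of phase vertices of $p$ and $q$ are contained in the closed $\epsilon(\lambda,c,k)$-neighborhoods of each other with respect to $dist_X$; (ii) if $s$ is an $\mathcal{H}$-component of $p$ with $dist_X(s_-,s_+)>\epsilon(\lambda,c,k)$, then some $\mathcal{H}$-component of $q$ is connected to $s$; (iii) if $s,t$ are connected $\mathcal{H}$-components of $p,q$ respectively, then $\max\{dist_X(s_-,t_-),dist_X(s_+,t_+)\}\leq\epsilon(\lambda,c,k)$. $G$ is hyperbolic relative to $\mathcal{H}$ if $\Gamma$ is a $\delta$-hyperbolic metric space for some $\delta\ge 0$ and $(G,\mathcal{H})$ satisfies BCP. A subgroup $Q\leq G$ is $\sigma$-quasiconvex (relative to $\mathcal{H}$), where $\sigma\geq0$, if for all $f,g\in Q$, every geodesic $p$ in $\Gamma$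 from $f$ to $g$ and every vertex $v$ of $p$, there is $w\in Q$ with $dist_X(v,w)\leq\sigma$. A subgroup of $G$ is parabolic if it can be conjugated in $G$ into one of the subgroups in $\mathcal{H}$. A maximal parabolic subgroup of $Q$ is a parabolic subgroup contained in $Q$ that is not properly contained in another parabolic subgroup contained in $Q$. *)

theory Defs
  imports Complex_Main "HOL-Algebra.Coset" "HOL-Algebra.Generated_Groups"
begin

section \<open>Word metric and conjugates\<close>

definition word_length :: "('a, 'b) monoid_scheme \<Rightarrow> 'a set \<Rightarrow> 'a \<Rightarrow> nat" where
  "word_length G X g =
     (LEAST n. \<exists>w. set w \<subseteq> X \<and> length w = n \<and> foldr (\<lambda>x y. x \<otimes>\<^bsub>G\<^esub> y) w \<one>\<^bsub>G\<^esub> = g)"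

definition word_dist :: "('a, 'b) monoid_scheme \<Rightarrow> 'a set \<Rightarrow> 'a \<Rightarrow> 'a \<Rightarrow> nat" where
  "word_dist G X f g = word_length G X (inv\<^bsub>G\<^esub> f \<otimes>\<^bsub>G\<^esub> g)"

definition conjugate :: "('a, 'b) monoid_scheme \<Rightarrow> 'a \<Rightarrow> 'a set \<Rightarrow> 'a set" where
  "conjugate G z H = z <#\<^bsub>G\<^esub> H #>\<^bsub>G\<^esub> inv\<^bsub>G\<^esub> z"

definition conjugacy_rel :: "('a, 'b) monoid_scheme \<Rightarrow> 'a set \<Rightarrow> ('a set \<times> 'a set) set" where
  "conjugacy_rel G Q = {(A, B). \<exists>q\<in>Q. B = conjugate G q A}"


section \<open>The relative Cayley graph and its paths\<close>

text \<open>
  The alphabet is a disjoint union: the same group element may occur as a letter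
  \<^term>\<open>Gen x\<close> and as letters \<^term>\<open>Per i x\<close> for several \<^term>\<open>i\<close>, and these are different labels.
\<close>

datatype 'a letter = Gen 'a | Per nat 'a

primrec letter_val :: "'a letter \<Rightarrow> 'a" where
  "letter_val (Gen x) = x"
| "letter_val (Per i h) = h"

definition alphabet ::
    "('a, 'b) monoid_scheme \<Rightarrow> 'a set \<Rightarrow> nat \<Rightarrow> (nat \<Rightarrow> 'a set) \<Rightarrow> 'a letter set" where
  "alphabet G X m H =
     {Gen x |x. x \<in> X} \<union> {Per i h |i h. i \<in> {1..m} \<and> h \<in> H i - {\<one>\<^bsub>G\<^esub>}}"

text \<open>
  A path is an initial vertex with the list of labels read along it. Every label is
  read forwards; since \<^term>\<open>X\<close> and the \<^term>\<open>H i\<close> are closed under inverses, travelling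
  against an edge labelled \<open>a\<close> is the same as following the edge labelled by the inverse
  of \<open>a\<close> in the same copy.
\<close>

type_synonym 'a gpath = "'a \<times> 'a letter list"

definition is_path ::
    "('a, 'b) monoid_scheme \<Rightarrow> 'a set \<Rightarrow> nat \<Rightarrow> (nat \<Rightarrow> 'a set) \<Rightarrow> 'a gpath \<Rightarrow> bool" where
  "is_path G X m H p \<longleftrightarrow> fst p \<in> carrier G \<and> set (snd p) \<subseteq> alphabet G X m H"

definition path_length :: "'a gpath \<Rightarrow> nat" where
  "path_length p = length (snd p)"

definition path_vertex :: "('a, 'b) monoid_scheme \<Rightarrow> 'a gpath \<Rightarrow> nat \<Rightarrow> 'a" where
  "path_vertex G p n = foldl (\<lambda>v a. v \<otimes>\<^bsub>G\<^esub> letter_val a) (fst p) (take n (snd p))"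

definition path_start :: "('a, 'b) monoid_scheme \<Rightarrow> 'a gpath \<Rightarrow> 'a" where
  "path_start G p = path_vertex G p 0"

definition path_end :: "('a, 'b) monoid_scheme \<Rightarrow> 'a gpath \<Rightarrow> 'a" where
  "path_end G p = path_vertex G p (path_length p)"

definition graph_dist ::
    "('a, 'b) monoid_scheme \<Rightarrow> 'a set \<Rightarrow> nat \<Rightarrow> (nat \<Rightarrow> 'a set) \<Rightarrow> 'a \<Rightarrow> 'a \<Rightarrow> nat" where
  "graph_dist G X m H f g =
     (LEAST n. \<exists>p. is_path G X m H p \<and> path_start G p = f \<and> path_end G p = g \<and> path_length p = n)"

definition geodesic_path ::
    "('a, 'b) monoid_scheme \<Rightarrow> 'a set \<Rightarrow> nat \<Rightarrow> (nat \<Rightarrow> 'a set) \<Rightarrow> 'a gpath \<Rightarrow> bool" where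
  "geodesic_path G X m H p \<longleftrightarrow>
     is_path G X m H p \<and> path_length p = graph_dist G X m H (path_start G p) (path_end G p)"

text \<open>
  Subpaths of \<^term>\<open>p\<close> are given by the positions \<open>j \<le> k \<le> path_length p\<close> of their endpoints.
\<close>

definition quasi_geodesic ::
    "('a, 'b) monoid_scheme \<Rightarrow> 'a set \<Rightarrow> nat \<Rightarrow> (nat \<Rightarrow> 'a set) \<Rightarrow> real \<Rightarrow> real \<Rightarrow> 'a gpath \<Rightarrow> bool" where
  "quasi_geodesic G X m H lam c p \<longleftrightarrow> is_path G X m H p \<and>
     (\<forall>j k. j \<le> k \<and> k \<le> path_length p \<longrightarrow>
        real (k - j) \<le> lam * real (graph_dist G X m H (path_vertex G p j) (path_vertex G p k)) + c)"


section \<open>Components\<close>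

definition per_subpath :: "nat \<Rightarrow> 'a gpath \<Rightarrow> nat \<times> nat \<Rightarrow> bool" where
  "per_subpath i p = (\<lambda>(j, k). j < k \<and> k \<le> path_length p \<and>
     (\<forall>l. j \<le> l \<and> l < k \<longrightarrow> (\<exists>h. snd p ! l = Per i h)))"

definition component_of :: "nat \<Rightarrow> 'a gpath \<Rightarrow> nat \<times> nat \<Rightarrow> bool" where
  "component_of i p s \<longleftrightarrow> per_subpath i p s \<and>
     (\<forall>t. per_subpath i p t \<and> fst t \<le> fst s \<and> snd s \<le> snd t \<longrightarrow> t = s)"

definition is_component :: "nat \<Rightarrow> 'a gpath \<Rightarrow> nat \<times> nat \<Rightarrow> bool" where
  "is_component m p s \<longleftrightarrow> (\<exists>i\<in>{1..m}. component_of i p s)"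

definition subpath_vertices :: "('a, 'b) monoid_scheme \<Rightarrow> 'a gpath \<Rightarrow> nat \<times> nat \<Rightarrow> 'a set" where
  "subpath_vertices G p s = path_vertex G p ` {fst s..snd s}"

definition connected_components ::
    "('a, 'b) monoid_scheme \<Rightarrow> nat \<Rightarrow> (nat \<Rightarrow> 'a set) \<Rightarrow>
      'a gpath \<Rightarrow> nat \<times> nat \<Rightarrow> 'a gpath \<Rightarrow> nat \<times> nat \<Rightarrow> bool" where
  "connected_components G m H p s q t \<longleftrightarrow>
     (\<exists>i\<in>{1..m}. component_of i p s \<and> component_of i q t \<and>
        (\<exists>x\<in>carrier G. subpath_vertices G p s \<union> subpath_vertices G q t \<subseteq> x <#\<^bsub>G\<^esub> H i))"

definition isolated_component ::
    "('a, 'b) monoid_scheme \<Rightarrow> nat \<Rightarrow> (nat \<Rightarrow> 'a set) \<Rightarrow> 'a gpath \<Rightarrow> nat \<times> nat \<Rightarrow> bool" where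
  "isolated_component G m H p s \<longleftrightarrow> is_component m p s \<and>
     \<not> (\<exists>t. is_component m p t \<and> t \<noteq> s \<and> connected_components G m H p s p t)"

definition without_backtracking ::
    "('a, 'b) monoid_scheme \<Rightarrow> nat \<Rightarrow> (nat \<Rightarrow> 'a set) \<Rightarrow> 'a gpath \<Rightarrow> bool" where
  "without_backtracking G m H p \<longleftrightarrow>
     (\<forall>s. is_component m p s \<longrightarrow> isolated_component G m H p s)"

text \<open>
  Being a phase vertex is a property of the position on the path, so that a path which
  returns to the same group element is treated correctly.
\<close>

definition phase_vertices :: "('a, 'b) monoid_scheme \<Rightarrow> nat \<Rightarrow> 'a gpath \<Rightarrow> 'a set" where
  "phase_vertices G m p =
     {path_vertex G p l |l. l \<le> path_length p \<and>
        \<not> (\<exists>s. is_component m p s \<and> fst s < l \<and> l < snd s)}"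


section \<open>Bounded coset penetration\<close>

definition similar_paths ::
    "('a, 'b) monoid_scheme \<Rightarrow> 'a set \<Rightarrow> real \<Rightarrow> 'a gpath \<Rightarrow> 'a gpath \<Rightarrow> bool" where
  "similar_paths G X k p q \<longleftrightarrow>
     real (max (word_dist G X (path_start G p) (path_start G q))
               (word_dist G X (path_end G p) (path_end G q))) \<le> k"

definition in_word_nbhd ::
    "('a, 'b) monoid_scheme \<Rightarrow> 'a set \<Rightarrow> nat \<Rightarrow> 'a set \<Rightarrow> 'a set \<Rightarrow> bool" where
  "in_word_nbhd G X e A B \<longleftrightarrow> (\<forall>a\<in>A. \<exists>b\<in>B. word_dist G X a b \<le> e)"

definition BCP :: "('a, 'b) monoid_scheme \<Rightarrow> 'a set \<Rightarrow> nat \<Rightarrow> (nat \<Rightarrow> 'a set) \<Rightarrow> bool" where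
  "BCP G X m H \<longleftrightarrow>
     (\<forall>lam c k :: real. lam \<ge> 1 \<and> c \<ge> 0 \<and> k \<ge> 0 \<longrightarrow>
       (\<exists>e::nat. e > 0 \<and>
         (\<forall>p q. quasi_geodesic G X m H lam c p \<and> quasi_geodesic G X m H lam c q \<and>
                without_backtracking G m H p \<and> without_backtracking G m H q \<and>
                similar_paths G X k p q \<longrightarrow>
            in_word_nbhd G X e (phase_vertices G m p) (phase_vertices G m q) \<and>
            in_word_nbhd G X e (phase_vertices G m q) (phase_vertices G m p) \<and>
            (\<forall>s. is_component m p s \<and>
                 word_dist G X (path_vertex G p (fst s)) (path_vertex G p (snd s)) > e \<longrightarrow>
                 (\<exists>t. is_component m q t \<and> connected_components G m H p s q t)) \<and>
            (\<forall>s t. is_component m p s \<and> is_component m q t \<and>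
                   connected_components G m H p s q t \<longrightarrow>
                 max (word_dist G X (path_vertex G p (fst s)) (path_vertex G q (fst t)))
                     (word_dist G X (path_vertex G p (snd s)) (path_vertex G q (snd t))) \<le> e))))"


section \<open>The graph as a metric space, and hyperbolicity\<close>

text \<open>
  Points of the geometric realization: the vertices, and the points at distance
  \<open>t\<close> from the initial vertex in the interior of the unit edge leaving \<open>g\<close> with label \<open>a\<close>.
\<close>

datatype 'a gpoint = Vertex 'a | EdgePoint 'a "'a letter" real

definition graph_points ::
    "('a, 'b) monoid_scheme \<Rightarrow> 'a set \<Rightarrow> nat \<Rightarrow> (nat \<Rightarrow> 'a set) \<Rightarrow> 'a gpoint set" where
  "graph_points G X m H =
     {Vertex g |g. g \<in> carrier G} \<union>
     {EdgePoint g a t |g a t. g \<in> carrier G \<and> a \<in> alphabet G X m H \<and> 0 < t \<and> t < 1}"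

text \<open>The vertices through which a point can be left, with the length needed to reach them.\<close>

fun exits :: "('a, 'b) monoid_scheme \<Rightarrow> 'a gpoint \<Rightarrow> ('a \<times> real) set" where
  "exits G (Vertex g) = {(g, 0)}"
| "exits G (EdgePoint g a t) = {(g, t), (g \<otimes>\<^bsub>G\<^esub> letter_val a, 1 - t)}"

definition dist_via_vertices ::
    "('a, 'b) monoid_scheme \<Rightarrow> 'a set \<Rightarrow> nat \<Rightarrow> (nat \<Rightarrow> 'a set) \<Rightarrow> 'a gpoint \<Rightarrow> 'a gpoint \<Rightarrow> real" where
  "dist_via_vertices G X m H x y =
     Min ((\<lambda>((u, s), (v, t)). s + real (graph_dist G X m H u v) + t) ` (exits G x \<times> exits G y))"

text \<open>
  The length metric. Even for two points of one edge a route through vertices can be the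
  shorter one, because an edge whose label has trivial value is a loop.
\<close>

fun point_dist ::
    "('a, 'b) monoid_scheme \<Rightarrow> 'a set \<Rightarrow> nat \<Rightarrow> (nat \<Rightarrow> 'a set) \<Rightarrow> 'a gpoint \<Rightarrow> 'a gpoint \<Rightarrow> real" where
  "point_dist G X m H (EdgePoint g a s) (EdgePoint h b t) =
     (if g = h \<and> a = b
      then min \<bar>s - t\<bar> (dist_via_vertices G X m H (EdgePoint g a s) (EdgePoint h b t))
      else dist_via_vertices G X m H (EdgePoint g a s) (EdgePoint h b t))"
| "point_dist G X m H x y = dist_via_vertices G X m H x y"

definition geodesic_segment ::
    "'p set \<Rightarrow> ('p \<Rightarrow> 'p \<Rightarrow> real) \<Rightarrow> 'p \<Rightarrow> 'p \<Rightarrow> 'p set \<Rightarrow> bool" where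
  "geodesic_segment M d x y S \<longleftrightarrow>
     (\<exists>L f. L \<ge> 0 \<and> f ` {0..L} = S \<and> S \<subseteq> M \<and> f 0 = x \<and> f L = y \<and>
        (\<forall>s\<in>{0..L}. \<forall>t\<in>{0..L}. d (f s) (f t) = \<bar>s - t\<bar>))"

text \<open>
  Hyperbolicity in the sense of Rips: the space is geodesic and each side of a geodesic
  triangle lies in the closed \<open>\<delta>\<close>-neighborhood of the union of the other two sides.
\<close>

definition hyperbolic_space :: "'p set \<Rightarrow> ('p \<Rightarrow> 'p \<Rightarrow> real) \<Rightarrow> real \<Rightarrow> bool" where
  "hyperbolic_space M d \<delta> \<longleftrightarrow>
     (\<forall>x\<in>M. \<forall>y\<in>M. \<exists>S. geodesic_segment M d x y S) \<and>
     (\<forall>x y z A B C. geodesic_segment M d x y A \<and> geodesic_segment M d y z B \<and>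
        geodesic_segment M d z x C \<longrightarrow> (\<forall>a\<in>A. \<exists>b\<in>B \<union> C. d a b \<le> \<delta>))"

definition relatively_hyperbolic ::
    "('a, 'b) monoid_scheme \<Rightarrow> 'a set \<Rightarrow> nat \<Rightarrow> (nat \<Rightarrow> 'a set) \<Rightarrow> bool" where
  "relatively_hyperbolic G X m H \<longleftrightarrow>
     (\<exists>\<delta>\<ge>0. hyperbolic_space (graph_points G X m H) (point_dist G X m H) \<delta>) \<and> BCP G X m H"


section \<open>Quasiconvex and parabolic subgroups\<close>

definition quasiconvex ::
    "('a, 'b) monoid_scheme \<Rightarrow> 'a set \<Rightarrow> nat \<Rightarrow> (nat \<Rightarrow> 'a set) \<Rightarrow> real \<Rightarrow> 'a set \<Rightarrow> bool" where
  "quasiconvex G X m H \<sigma> Q \<longleftrightarrow> subgroup Q G \<and> \<sigma> \<ge> 0 \<and>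
     (\<forall>f\<in>Q. \<forall>g\<in>Q. \<forall>p. geodesic_path G X m H p \<and> path_start G p = f \<and> path_end G p = g \<longrightarrow>
        (\<forall>l\<le>path_length p. \<exists>w\<in>Q. real (word_dist G X (path_vertex G p l) w) \<le> \<sigma>))"

definition parabolic ::
    "('a, 'b) monoid_scheme \<Rightarrow> nat \<Rightarrow> (nat \<Rightarrow> 'a set) \<Rightarrow> 'a set \<Rightarrow> bool" where
  "parabolic G m H P \<longleftrightarrow> subgroup P G \<and>
     (\<exists>g\<in>carrier G. \<exists>i\<in>{1..m}. conjugate G g P \<subseteq> H i)"

definition maximal_parabolic ::
    "('a, 'b) monoid_scheme \<Rightarrow> nat \<Rightarrow> (nat \<Rightarrow> 'a set) \<Rightarrow> 'a set \<Rightarrow> 'a set \<Rightarrow> bool" where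
  "maximal_parabolic G m H Q P \<longleftrightarrow> parabolic G m H P \<and> P \<subseteq> Q \<and>
     \<not> (\<exists>P'. parabolic G m H P' \<and> P' \<subseteq> Q \<and> P \<subset> P')"

end

theory Submission
  imports Defs
begin

text \<open>
  Let \<open>P\<close> be an infinite maximal parabolic subgroup of \<open>Q\<close>. By maximality
  \<open>P = Q \<inter> gHg\<inverse>\<close> for some \<open>g \<in> G\<close> and \<open>H \<in> \<H>\<close>
  (\<open>maximal_parabolic_eq_Int\<close>). A nontrivial element \<open>a \<in> P\<close> maps the coset \<open>gH\<close> to itself, so an
  edge with label in the copy of \<open>H\<close> leads from \<open>g\<close> to \<open>ag\<close>. Compare it with a geodesic from
  \<open>1\<close> to \<open>a\<close>: the initial vertices are at word distance \<open>|g|\<close>, and so are the terminal ones.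
  Thus the two paths are \<open>|g|\<close>-similar, where \<open>|g|\<close> does not depend on \<open>a\<close>, and both are
  geodesics, hence \<open>(1,0)\<close>-quasi-geodesics without backtracking. Since \<open>P\<close> is
  infinite and word balls are finite, \<open>a\<close> can be chosen such that the edge is longer, in
  the word metric, than the constant of bounded coset penetration for \<open>(1, 0, |g|)\<close>. Then the
  geodesic has a component connected to the edge, so it passes through a vertex \<open>gh\<close> of
  the coset \<open>gH\<close> (\<open>geodesic_meets_coset\<close>).

  The ends \<open>1\<close> and \<open>a\<close> of the geodesic lie in \<open>Q\<close>, so quasiconvexity puts \<open>gh\<close> within
  \<open>\<sigma>\<close> of some \<open>w \<in> Q\<close>. With \<open>z = w\<inverse>gh\<close> this says \<open>|z| \<le> \<sigma>\<close>, and
  conjugating \<open>P\<close> by \<open>w\<inverse> \<in> Q\<close> gives \<open>Q \<inter> zHz\<inverse>\<close>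
  (\<open>maximal_parabolic_conjugate_near\<close>). Only finitely many subgroups have this form, and each
  conjugacy class of infinite maximal parabolic subgroups is the class of one of them.
\<close>

section \<open>Conjugates of subgroups\<close>

context group
begin

lemma mult_inv_cancel_left:
  assumes "x \<in> carrier G" "y \<in> carrier G"
  shows "inv x \<otimes> (x \<otimes> y) = y" and "x \<otimes> (inv x \<otimes> y) = y"
  using assms by (simp_all flip: m_assoc)

lemma conjugate_eq_image:
  "conjugate G z A = (\<lambda>a. z \<otimes> a \<otimes> inv z) ` A"
  by (auto simp: conjugate_def l_coset_def r_coset_def)

lemma mem_conjugate_iff:
  assumes "z \<in> carrier G" "A \<subseteq> carrier G"
  shows "x \<in> conjugate G z A \<longleftrightarrow> x \<in> carrier G \<and> inv z \<otimes> x \<otimes> z \<in> A"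
proof
  assume "x \<in> conjugate G z A"
  then obtain a where a: "a \<in> A" "x = z \<otimes> a \<otimes> inv z"
    by (auto simp: conjugate_eq_image)
  with assms have c: "a \<in> carrier G" by auto
  have "inv z \<otimes> x \<otimes> z = a"
    using a(2) c assms(1) by (simp add: m_assoc mult_inv_cancel_left)
  with a c assms(1) show "x \<in> carrier G \<and> inv z \<otimes> x \<otimes> z \<in> A" by simp
next
  assume x: "x \<in> carrier G \<and> inv z \<otimes> x \<otimes> z \<in> A"
  then have "x = z \<otimes> (inv z \<otimes> x \<otimes> z) \<otimes> inv z"
    using assms(1) by (simp add: m_assoc mult_inv_cancel_left)
  with x show "x \<in> conjugate G z A"
    unfolding conjugate_eq_image by blast
qed

lemma conjugate_subset_carrier:
  assumes "z \<in> carrier G" "A \<subseteq> carrier G"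
  shows "conjugate G z A \<subseteq> carrier G"
  using assms by (auto simp: mem_conjugate_iff)

lemma conjugate_conjugate:
  assumes "y \<in> carrier G" "z \<in> carrier G" "A \<subseteq> carrier G"
  shows "conjugate G y (conjugate G z A) = conjugate G (y \<otimes> z) A"
proof -
  have "y \<otimes> (z \<otimes> a \<otimes> inv z) \<otimes> inv y = y \<otimes> z \<otimes> a \<otimes> inv (y \<otimes> z)" if "a \<in> A" for a
    using assms that by (auto simp: m_assoc inv_mult_group subset_iff)
  then show ?thesis
    unfolding conjugate_eq_image image_image by (intro image_cong) auto
qed

lemma conjugate_Int:
  assumes "z \<in> carrier G" "A \<subseteq> carrier G" "B \<subseteq> carrier G"
  shows "conjugate G z (A \<inter> B) = conjugate G z A \<inter> conjugate G z B"
  using assms by (auto simp: mem_conjugate_iff le_infI1)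

lemma conjugate_by_member:
  assumes "subgroup K G" "k \<in> K"
  shows "conjugate G k K = K"
proof -
  interpret K: subgroup K G by fact
  have k: "k \<in> carrier G" using assms by (rule subgroup.mem_carrier)
  have "x \<in> K" if "x \<in> carrier G" "inv k \<otimes> x \<otimes> k \<in> K" for x
  proof -
    have "k \<otimes> (inv k \<otimes> x \<otimes> k) \<otimes> inv k \<in> K"
      by (rule K.m_closed[OF K.m_closed[OF assms(2) that(2)] K.m_inv_closed[OF assms(2)]])
    also have "k \<otimes> (inv k \<otimes> x \<otimes> k) \<otimes> inv k = x"
      using that(1) k by (simp add: m_assoc mult_inv_cancel_left)
    finally show ?thesis .
  qed
  moreover have "inv k \<otimes> x \<otimes> k \<in> K" if "x \<in> K" for x
    by (rule K.m_closed[OF K.m_closed[OF K.m_inv_closed[OF assms(2)] that] assms(2)])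
  ultimately have "x \<in> conjugate G k K \<longleftrightarrow> x \<in> K" for x
    unfolding mem_conjugate_iff[OF k K.subset] using K.mem_carrier by blast
  then show ?thesis by blast
qed

lemma subgroup_conjugate:
  assumes "subgroup K G" "z \<in> carrier G"
  shows "subgroup (conjugate G z K) G"
proof -
  interpret K: subgroup K G by fact
  have eq: "inv z \<otimes> (x \<otimes> y) \<otimes> z = (inv z \<otimes> x \<otimes> z) \<otimes> (inv z \<otimes> y \<otimes> z)"
    if "x \<in> carrier G" "y \<in> carrier G" for x y
    using that assms(2) by (simp add: m_assoc mult_inv_cancel_left)
  have eq': "inv z \<otimes> inv x \<otimes> z = inv (inv z \<otimes> x \<otimes> z)" if "x \<in> carrier G" for x
    using that assms(2) by (simp add: m_assoc inv_mult_group)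
  show ?thesis
  proof (rule subgroup.intro)
    show "conjugate G z K \<subseteq> carrier G"
      using assms(2) K.subset by (rule conjugate_subset_carrier)
  qed (use assms(2) in \<open>simp_all add: mem_conjugate_iff[OF assms(2) K.subset] eq eq'\<close>)
qed

lemma conjugate_inv_cancel:
  assumes "z \<in> carrier G" "A \<subseteq> carrier G"
  shows "conjugate G (inv z) (conjugate G z A) = A"
    and "conjugate G z (conjugate G (inv z) A) = A"
proof -
  have "conjugate G \<one> A = A"
    using assms(2) by (force simp: conjugate_eq_image image_iff subset_iff)
  then show "conjugate G (inv z) (conjugate G z A) = A"
    and "conjugate G z (conjugate G (inv z) A) = A"
    using assms by (simp_all add: conjugate_conjugate)
qed

lemma conjugate_mono: "A \<subseteq> B \<Longrightarrow> conjugate G z A \<subseteq> conjugate G z B"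
  by (auto simp: conjugate_eq_image)

text \<open>
  \<^const>\<open>conjugacy_rel\<close> relates arbitrary sets, so the class of a set may leave the family
  under consideration. It is still the orbit of the set under \<open>Q\<close>, and two sets of one orbit
  have the same orbit.
\<close>

lemma conjugacy_class_conjugate:
  assumes "subgroup Q G" "q \<in> Q" "A \<subseteq> carrier G"
  shows "conjugacy_rel G Q `` {conjugate G q A} = conjugacy_rel G Q `` {A}"
proof -
  interpret Q: subgroup Q G by fact
  have q: "q \<in> carrier G" using assms(1,2) by (rule subgroup.mem_carrier)
  have "\<exists>r\<in>Q. conjugate G s (conjugate G q A) = conjugate G r A" if "s \<in> Q" for s
    using that assms q by (intro bexI[of _ "s \<otimes> q"]) (auto simp: conjugate_conjugate)
  moreover have "\<exists>r\<in>Q. conjugate G s A = conjugate G r (conjugate G q A)" if "s \<in> Q" for s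
    using that assms q
    by (intro bexI[of _ "s \<otimes> inv q"]) (auto simp: conjugate_conjugate m_assoc)
  ultimately show ?thesis
    by (auto simp: conjugacy_rel_def)
qed

end

section \<open>The word metric\<close>

locale relative_cayley_graph = group G for G (structure) +
  fixes X :: "'a set" and m :: nat and H :: "nat \<Rightarrow> 'a set"
  assumes finite_X: "finite X"
    and X_subset: "X \<subseteq> carrier G"
    and X_inv: "x \<in> X \<Longrightarrow> inv x \<in> X"
    and generate_X: "generate G X = carrier G"
    and subgroup_H: "i \<in> {1..m} \<Longrightarrow> subgroup (H i) G"
begin

abbreviation word_prod :: "'a list \<Rightarrow> 'a"
  where "word_prod w \<equiv> foldr (\<lambda>x y. x \<otimes> y) w \<one>"

lemma word_prod_closed: "set w \<subseteq> X \<Longrightarrow> word_prod w \<in> carrier G"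
  using X_subset by (induction w) auto

lemma word_prod_append:
  "set v \<subseteq> X \<Longrightarrow> set w \<subseteq> X \<Longrightarrow> word_prod (v @ w) = word_prod v \<otimes> word_prod w"
proof (induction v)
  case (Cons x v)
  then have "x \<in> carrier G" "word_prod v \<in> carrier G" "word_prod w \<in> carrier G"
    using X_subset word_prod_closed by auto
  with Cons show ?case by (simp add: m_assoc)
qed (simp add: word_prod_closed)

lemma word_exists:
  assumes "g \<in> carrier G"
  shows "\<exists>w. set w \<subseteq> X \<and> word_prod w = g"
proof -
  have "g \<in> generate G X" using assms generate_X by simp
  then show ?thesis
  proof (induction rule: generate.induct)
    case one
    show ?case by (intro exI[of _ "[]"]) simp
  next
    case (incl h)
    then show ?case using X_subset by (intro exI[of _ "[h]"]) auto
  next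
    case (inv h)
    then show ?case using X_subset X_inv by (intro exI[of _ "[inv h]"]) auto
  next
    case (eng h k)
    then obtain v w where "set v \<subseteq> X" "word_prod v = h" "set w \<subseteq> X" "word_prod w = k"
      by blast
    then show ?case by (intro exI[of _ "v @ w"]) (simp add: word_prod_append del: foldr_append)
  qed
qed

lemma shortest_word:
  assumes "g \<in> carrier G"
  obtains w where "set w \<subseteq> X" "length w = word_length G X g" "word_prod w = g"
proof -
  have "\<exists>n w. set w \<subseteq> X \<and> length w = n \<and> word_prod w = g"
    using word_exists[OF assms] by blast
  from LeastI_ex[OF this] that show ?thesis
    unfolding word_length_def by blast
qed

lemma word_length_le:
  "set w \<subseteq> X \<Longrightarrow> word_prod w = g \<Longrightarrow> word_length G X g \<le> length w"
  unfolding word_length_def by (rule Least_le) blast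

lemma word_length_inv_le:
  assumes "g \<in> carrier G"
  shows "word_length G X (inv g) \<le> word_length G X g"
proof -
  obtain w where w: "set w \<subseteq> X" "length w = word_length G X g" "word_prod w = g"
    using assms by (rule shortest_word)
  have "word_prod (rev (map (m_inv G) u)) = inv (word_prod u)" if "set u \<subseteq> X" for u
    using that
  proof (induction u)
    case (Cons x u)
    have x: "x \<in> carrier G" "inv x \<in> carrier G" "word_prod u \<in> carrier G"
      using Cons.prems X_subset word_prod_closed[of u] by auto
    have "set (rev (map (m_inv G) u)) \<subseteq> X" "set [inv x] \<subseteq> X"
      using Cons.prems X_inv by auto
    from word_prod_append[OF this]
    have "word_prod (rev (map (m_inv G) (x # u))) = inv (word_prod u) \<otimes> inv x"
      using Cons x by (simp del: foldr_append)
    with x show ?case by (simp add: inv_mult_group)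
  qed simp
  then have "word_prod (rev (map (m_inv G) w)) = inv g"
    using w by blast
  moreover have "set (rev (map (m_inv G) w)) \<subseteq> X"
    using w(1) X_inv by auto
  ultimately have "word_length G X (inv g) \<le> length (rev (map (m_inv G) w))"
    by (intro word_length_le)
  with w(2) show ?thesis by simp
qed

lemma finite_word_ball:
  "finite {g \<in> carrier G. word_length G X g \<le> n}"
proof (rule finite_subset)
  show "{g \<in> carrier G. word_length G X g \<le> n} \<subseteq> word_prod ` {w. set w \<subseteq> X \<and> length w \<le> n}"
  proof
    fix g assume g: "g \<in> {g \<in> carrier G. word_length G X g \<le> n}"
    then obtain w where "set w \<subseteq> X" "length w = word_length G X g" "word_prod w = g"
      by (auto elim: shortest_word)
    with g show "g \<in> word_prod ` {w. set w \<subseteq> X \<and> length w \<le> n}" by auto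
  qed
  show "finite (word_prod ` {w. set w \<subseteq> X \<and> length w \<le> n})"
    using finite_lists_length_le[OF finite_X] by blast
qed

section \<open>Geodesics in the relative Cayley graph\<close>

lemma letter_val_closed:
  assumes "a \<in> alphabet G X m H"
  shows "letter_val a \<in> carrier G"
proof -
  have "H i \<subseteq> carrier G" if "i \<in> {1..m}" for i
    using subgroup_H[OF that] by (rule subgroup.subset)
  then have "h \<in> carrier G" if "i \<in> {1..m}" "h \<in> H i" for i h
    using that by blast
  with assms X_subset show ?thesis
    unfolding alphabet_def by force
qed

abbreviation follow :: "'a \<Rightarrow> 'a letter list \<Rightarrow> 'a"
  where "follow \<equiv> foldl (\<lambda>v a. v \<otimes> letter_val a)"

lemma follow_closed:
  "v \<in> carrier G \<Longrightarrow> set ls \<subseteq> alphabet G X m H \<Longrightarrow> follow v ls \<in> carrier G"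
  by (induction ls arbitrary: v) (auto simp: letter_val_closed)

lemma path_end_eq: "path_end G p = follow (fst p) (snd p)"
  by (simp add: path_end_def path_vertex_def path_length_def)

lemma path_start_eq: "path_start G p = fst p"
  by (simp add: path_start_def path_vertex_def)

lemma path_vertex_closed:
  assumes "is_path G X m H p"
  shows "path_vertex G p n \<in> carrier G"
  unfolding path_vertex_def
  using assms by (intro follow_closed) (auto simp: is_path_def dest: in_set_takeD)

lemma graph_dist_le:
  "is_path G X m H p \<Longrightarrow> graph_dist G X m H (path_start G p) (path_end G p) \<le> path_length p"
  unfolding graph_dist_def by (rule Least_le) blast

lemma follow_word:
  "v \<in> carrier G \<Longrightarrow> set w \<subseteq> X \<Longrightarrow> follow v (map Gen w) = v \<otimes> word_prod w"
proof (induction w arbitrary: v)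
  case (Cons x w)
  then have "x \<in> carrier G" "word_prod w \<in> carrier G"
    using X_subset word_prod_closed by auto
  with Cons show ?case by (simp add: m_assoc)
qed simp

text \<open>The graph is connected already through edges with labels in \<open>X\<close>.\<close>

lemma geodesic_exists:
  assumes "f \<in> carrier G" "g \<in> carrier G"
  obtains p where "geodesic_path G X m H p" "path_start G p = f" "path_end G p = g"
proof -
  obtain w where w: "set w \<subseteq> X" "word_prod w = inv f \<otimes> g"
    using word_exists[of "inv f \<otimes> g"] assms by auto
  have "is_path G X m H (f, map Gen w)"
    using w assms by (auto simp: is_path_def alphabet_def)
  moreover have "path_end G (f, map Gen w) = g"
    using w assms by (simp add: path_end_eq follow_word m_assoc[symmetric])
  ultimately have "\<exists>n p. is_path G X m H p \<and> path_start G p = f \<and> path_end G p = g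
      \<and> path_length p = n"
    by (metis path_start_eq fst_conv)
  \<comment> \<open>This path shows that the minimum defining the graph distance is attained.\<close>
  from LeastI_ex[OF this] that show ?thesis
    unfolding geodesic_path_def graph_dist_def by metis
qed

text \<open>
  A geodesic between two vertices of a geodesic could be spliced in for the part between
  them, so it cannot be shorter than that part.
\<close>

lemma geodesic_subpath:
  assumes p: "geodesic_path G X m H p" and jk: "j \<le> k" "k \<le> path_length p"
  shows "k - j \<le> graph_dist G X m H (path_vertex G p j) (path_vertex G p k)"
proof -
  have path: "is_path G X m H p" using p by (simp add: geodesic_path_def)
  obtain r where r: "geodesic_path G X m H r"
    "path_start G r = path_vertex G p j" "path_end G r = path_vertex G p k"
    using geodesic_exists[OF path_vertex_closed[OF path] path_vertex_closed[OF path]] by blast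
  let ?s = "(fst p, take j (snd p) @ snd r @ drop k (snd p))"
  have s: "is_path G X m H ?s"
    using path r(1)
    by (auto simp: is_path_def geodesic_path_def dest: in_set_takeD in_set_dropD)
  have "path_end G ?s = follow (follow (fst r) (snd r)) (drop k (snd p))"
    using r(2) by (simp add: path_end_eq path_start_eq path_vertex_def)
  also have "\<dots> = follow (follow (fst p) (take k (snd p))) (drop k (snd p))"
    using r(3) by (simp add: path_end_eq path_vertex_def)
  also have "\<dots> = path_end G p"
    by (simp add: path_end_eq flip: foldl_append)
  finally have "path_length p \<le> path_length ?s"
    using graph_dist_le[OF s] p by (simp add: geodesic_path_def path_start_eq)
  then have "k - j \<le> path_length r"
    using jk by (simp add: path_length_def)
  with r show ?thesis by (simp add: geodesic_path_def)
qed

lemma geodesic_quasi_geodesic: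
  assumes p: "geodesic_path G X m H p"
  shows "quasi_geodesic G X m H 1 0 p"
proof -
  have "real (k - j) \<le> 1 * real (graph_dist G X m H (path_vertex G p j) (path_vertex G p k)) + 0"
    if "j \<le> k \<and> k \<le> path_length p" for j k
    using of_nat_mono[OF geodesic_subpath[OF p, of j k], where 'a = real] that by simp
  with p show ?thesis
    unfolding quasi_geodesic_def geodesic_path_def by blast
qed

lemma component_of_bounds:
  assumes "component_of i p s"
  shows "fst s < snd s" and "snd s \<le> path_length p"
proof -
  have "per_subpath i p s" using assms by (simp add: component_of_def)
  then show "fst s < snd s" "snd s \<le> path_length p"
    unfolding per_subpath_def by (cases s; simp)+
qed

lemma mem_coset_inv_mult:
  assumes "i \<in> {1..m}" "x \<in> carrier G" "u \<in> x <# H i" "v \<in> x <# H i"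
  shows "inv u \<otimes> v \<in> H i"
proof -
  interpret K: subgroup "H i" G using assms(1) by (rule subgroup_H)
  obtain a b where "a \<in> H i" "b \<in> H i" "u = x \<otimes> a" "v = x \<otimes> b"
    using assms(3,4) by (auto simp: l_coset_def)
  moreover from this have "inv u \<otimes> v = inv a \<otimes> b"
    using assms(2) by (simp add: inv_mult_group m_assoc mult_inv_cancel_left)
  ultimately show ?thesis by simp
qed

lemma graph_dist_coset_le_one:
  assumes i: "i \<in> {1..m}" and uv: "u \<in> carrier G" "v \<in> carrier G" "inv u \<otimes> v \<in> H i"
  shows "graph_dist G X m H u v \<le> 1"
proof -
  define ls where "ls = (if u = v then [] else [Per i (inv u \<otimes> v)])"
  have "inv u \<otimes> v \<noteq> \<one>" if "u \<noteq> v"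
    using that uv by (metis inv_equality inv_closed inv_inv)
  then have "is_path G X m H (u, ls)"
    using i uv by (auto simp: ls_def is_path_def alphabet_def)
  moreover have "path_end G (u, ls) = v"
    using uv by (simp add: ls_def path_end_eq flip: m_assoc)
  ultimately show ?thesis
    using graph_dist_le[of "(u, ls)"]
    by (simp add: path_start_eq path_length_def ls_def split: if_splits)
qed

text \<open>
  All vertices of two connected components lie within distance one of each other, so on a
  geodesic both components are the same single edge.
\<close>

lemma geodesic_without_backtracking:
  assumes p: "geodesic_path G X m H p"
  shows "without_backtracking G m H p"
proof -
  have path: "is_path G X m H p" using p by (simp add: geodesic_path_def)
  have "s = t" if conn: "connected_components G m H p s p t" for s t
  proof -
    obtain i x where i: "i \<in> {1..m}" "component_of i p s" "component_of i p t"
      and x: "x \<in> carrier G" "subpath_vertices G p s \<union> subpath_vertices G p t \<subseteq> x <# H i"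
      using conn by (auto simp: connected_components_def)
    have st: "fst s < snd s" "snd s \<le> path_length p" "fst t < snd t" "snd t \<le> path_length p"
      using component_of_bounds[OF i(2)] component_of_bounds[OF i(3)] by auto
    have near: "k \<le> j + 1" if "path_vertex G p j \<in> x <# H i" "path_vertex G p k \<in> x <# H i"
      "j \<le> k" "k \<le> path_length p" for j k
    proof -
      have "k - j \<le> graph_dist G X m H (path_vertex G p j) (path_vertex G p k)"
        using that(3,4) by (rule geodesic_subpath[OF p])
      also have "\<dots> \<le> 1"
        using path_vertex_closed[OF path] path_vertex_closed[OF path]
          mem_coset_inv_mult[OF i(1) x(1) that(1,2)]
        by (rule graph_dist_coset_le_one[OF i(1)])
      finally show ?thesis by simp
    qed
    have in_coset: "path_vertex G p j \<in> x <# H i" if "j \<in> {fst s..snd s} \<union> {fst t..snd t}" for j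
      using x(2) that unfolding subpath_vertices_def by blast
    have "snd s \<le> fst s + 1" "snd t \<le> fst t + 1"
      using near[of "fst s" "snd s"] near[of "fst t" "snd t"] st in_coset by auto
    moreover have "snd t \<le> fst s + 1" if "fst s \<le> fst t"
      using near[of "fst s" "snd t"] that st in_coset by auto
    moreover have "snd s \<le> fst t + 1" if "fst t \<le> fst s"
      using near[of "fst t" "snd s"] that st in_coset by auto
    ultimately show "s = t"
      using st by (cases s, cases t) fastforce
  qed
  then show ?thesis
    by (auto simp: without_backtracking_def isolated_component_def)
qed

text \<open>
  The path to which bounded coset penetration will be applied: a single edge that is a
  component. It is a geodesic because its ends differ.
\<close>

lemma peripheral_edge:
  assumes "i \<in> {1..m}" "g \<in> carrier G" "h \<in> H i" "h \<noteq> \<one>"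
  shows "geodesic_path G X m H (g, [Per i h])"
    and "component_of j (g, [Per i h]) (0, 1) \<longleftrightarrow> j = i"
    and "path_vertex G (g, [Per i h]) 0 = g"
    and "path_vertex G (g, [Per i h]) 1 = g \<otimes> h"
proof -
  have h: "h \<in> carrier G" using subgroup_H[OF assms(1)] assms(3) by (rule subgroup.mem_carrier)
  let ?e = "(g, [Per i h])"
  have e: "is_path G X m H ?e" using assms by (auto simp: is_path_def alphabet_def)
  obtain r where r: "geodesic_path G X m H r" "path_start G r = g" "path_end G r = g \<otimes> h"
    using geodesic_exists[OF assms(2) m_closed[OF assms(2) h]] by blast
  have "g \<otimes> h \<noteq> g" using assms(2,4) h by (simp add: r_cancel_one)
  then have "path_length r \<noteq> 0"
    using r(2,3) unfolding path_start_def path_end_def by metis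
  then have "1 \<le> graph_dist G X m H g (g \<otimes> h)"
    using r by (simp add: geodesic_path_def)
  moreover have "graph_dist G X m H g (g \<otimes> h) \<le> 1"
    using graph_dist_le[OF e] by (simp add: path_start_eq path_end_eq path_length_def)
  ultimately show "geodesic_path G X m H ?e"
    using e by (simp add: geodesic_path_def path_start_eq path_end_eq path_length_def)
  have "per_subpath j ?e t \<longleftrightarrow> t = (0, 1) \<and> j = i" for t
  proof (cases t)
    case (Pair a b)
    have "a < b \<and> b \<le> 1 \<longleftrightarrow> a = 0 \<and> b = 1" by linarith
    then show ?thesis
      unfolding Pair per_subpath_def by (auto simp: path_length_def)
  qed
  then show "component_of j ?e (0, 1) \<longleftrightarrow> j = i"
    unfolding component_of_def by blast
  show "path_vertex G ?e 0 = g" "path_vertex G ?e 1 = g \<otimes> h"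
    by (simp_all add: path_vertex_def)
qed

section \<open>Infinite parabolic subgroups\<close>

text \<open>
  The elements of \<open>A\<close> stabilize the coset \<open>gH\<^sub>i\<close> and, being infinitely many, move \<open>g\<close>
  arbitrarily far in the word metric, while \<open>a\<close> and \<open>ag\<close> stay at distance \<open>|g|\<close>. A geodesic from \<open>1\<close> to \<open>a\<close> can
  accompany the long edge from \<open>g\<close> to \<open>ag\<close> only by penetrating the same coset.
\<close>

lemma geodesic_meets_coset:
  assumes BCP: "BCP G X m H" and i: "i \<in> {1..m}" and g: "g \<in> carrier G"
    and A: "infinite A" "A \<subseteq> conjugate G g (H i)"
  obtains a p l h where "a \<in> A" "geodesic_path G X m H p" "path_start G p = \<one>" "path_end G p = a"
    "l \<le> path_length p" "h \<in> H i" "path_vertex G p l = g \<otimes> h"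
proof -
  interpret K: subgroup "H i" G using i by (rule subgroup_H)
  define k where "k = real (word_length G X (inv g))"
  obtain e where e: "\<And>p q s. quasi_geodesic G X m H 1 0 p \<Longrightarrow> quasi_geodesic G X m H 1 0 q \<Longrightarrow>
      without_backtracking G m H p \<Longrightarrow> without_backtracking G m H q \<Longrightarrow>
      similar_paths G X k p q \<Longrightarrow> is_component m p s \<Longrightarrow>
      e < word_dist G X (path_vertex G p (fst s)) (path_vertex G p (snd s)) \<Longrightarrow>
      \<exists>t. is_component m q t \<and> connected_components G m H p s q t"
  proof -
    have "(1::real) \<le> 1 \<and> (0::real) \<le> 0 \<and> 0 \<le> k" by (simp add: k_def)
    with BCP show ?thesis
      unfolding BCP_def using that by meson
  qed
  have Ac: "A \<subseteq> carrier G"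
    using A(2) g conjugate_subset_carrier K.subset by blast
  \<comment> \<open>The edge from \<open>g\<close> to \<open>ag\<close> has label \<open>inv g \<otimes> a \<otimes> g\<close>, which is long for all but finitely
    many \<open>a \<in> A\<close>. Exceeding the length of \<open>\<one>\<close> as well makes the label nontrivial, as the
    letters of the alphabet are.\<close>
  obtain a where a: "a \<in> A" and long: "max e (word_length G X \<one>) < word_length G X (inv g \<otimes> a \<otimes> g)"
  proof -
    have "inj_on (\<lambda>a. inv g \<otimes> a \<otimes> g) A"
      using g Ac by (auto intro!: inj_onI simp: subset_iff)
    with A(1) have "infinite ((\<lambda>a. inv g \<otimes> a \<otimes> g) ` A)"
      by (simp add: finite_image_iff)
    then have "\<not> (\<lambda>a. inv g \<otimes> a \<otimes> g) ` A
        \<subseteq> {b \<in> carrier G. word_length G X b \<le> max e (word_length G X \<one>)}"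
      using finite_word_ball finite_subset by blast
    then obtain a where a: "a \<in> A" "inv g \<otimes> a \<otimes> g
        \<notin> {b \<in> carrier G. word_length G X b \<le> max e (word_length G X \<one>)}"
      by blast
    moreover have "a \<in> carrier G" using a(1) Ac by blast
    ultimately show ?thesis using g by (intro that[of a]) auto
  qed
  define h where "h = inv g \<otimes> a \<otimes> g"
  have ac: "a \<in> carrier G" using a Ac by blast
  have h: "h \<in> H i"
    using a A(2) g mem_conjugate_iff K.subset unfolding h_def by blast
  have h1: "h \<noteq> \<one>" using long unfolding h_def[symmetric] by auto
  have gh: "g \<otimes> h = a \<otimes> g"
    using g ac by (simp add: h_def flip: m_assoc)
  let ?s = "(g, [Per i h])"
  note edge = peripheral_edge[OF i g h h1]
  obtain p where p: "geodesic_path G X m H p" "path_start G p = \<one>" "path_end G p = a"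
    using geodesic_exists[OF one_closed ac] by blast
  have "inv (a \<otimes> g) \<otimes> a = inv g"
    using g ac by (simp add: inv_mult_group m_assoc)
  then have "similar_paths G X k ?s p"
    using p g gh edge(3,4)
    by (simp add: similar_paths_def word_dist_def k_def path_start_eq path_end_eq)
  moreover have "is_component m ?s (0, 1)"
    using edge(2) i by (auto simp: is_component_def)
  moreover have "inv g \<otimes> (g \<otimes> h) = h"
    using g h by (simp flip: m_assoc)
  then have "e < word_dist G X (path_vertex G ?s 0) (path_vertex G ?s 1)"
    using long edge(3,4) by (simp add: word_dist_def h_def)
  ultimately obtain t where "connected_components G m H ?s (0, 1) p t"
    using e[of ?s p "(0, 1)"] p(1) edge(1)
    by (auto simp: geodesic_quasi_geodesic geodesic_without_backtracking)
  then obtain x where x: "x \<in> carrier G" "component_of i p t"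
    "subpath_vertices G ?s (0, 1) \<union> subpath_vertices G p t \<subseteq> x <# H i"
    unfolding connected_components_def edge(2) by blast
  have t: "fst t < snd t" "snd t \<le> path_length p"
    using component_of_bounds[OF x(2)] by auto
  let ?v = "path_vertex G p (fst t)"
  have "path_vertex G ?s 0 \<in> x <# H i" "?v \<in> x <# H i"
    using x(3) t by (auto simp: subpath_vertices_def)
  with edge(3) have "inv g \<otimes> ?v \<in> H i"
    using mem_coset_inv_mult[OF i x(1)] by simp
  moreover have "?v = g \<otimes> (inv g \<otimes> ?v)"
    using g p(1) path_vertex_closed[of p "fst t"] by (simp add: geodesic_path_def flip: m_assoc)
  ultimately show ?thesis
    using that[OF a p, of "fst t"] t by simp
qed

text \<open>
  The intersection of \<open>Q\<close> with a conjugate of \<open>H\<^sub>i\<close> is itself parabolic, so a maximal \<open>P\<close>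
  contained in it must fill it.
\<close>

lemma maximal_parabolic_eq_Int:
  assumes "subgroup Q G" "maximal_parabolic G m H Q P"
  obtains g i where "g \<in> carrier G" "i \<in> {1..m}" "P = Q \<inter> conjugate G g (H i)"
proof -
  obtain f i where f: "f \<in> carrier G" "i \<in> {1..m}" "conjugate G f P \<subseteq> H i"
    and P: "subgroup P G" "P \<subseteq> Q"
    using assms(2) by (auto simp: maximal_parabolic_def parabolic_def)
  have Hi: "subgroup (H i) G" using f(2) by (rule subgroup_H)
  let ?R = "Q \<inter> conjugate G (inv f) (H i)"
  have "conjugate G (inv f) (conjugate G f P) \<subseteq> conjugate G (inv f) (H i)"
    using f(3) by (rule conjugate_mono)
  then have "P \<subseteq> ?R"
    using P f(1) subgroup.subset[OF P(1)] by (simp add: conjugate_inv_cancel)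
  moreover have "parabolic G m H ?R"
  proof -
    have "conjugate G f ?R \<subseteq> conjugate G f (conjugate G (inv f) (H i))"
      by (rule conjugate_mono) blast
    then have "conjugate G f ?R \<subseteq> H i"
      using f(1) subgroup.subset[OF Hi] by (simp add: conjugate_inv_cancel)
    then show ?thesis
      unfolding parabolic_def
      using f(1,2) subgroups_Inter_pair[OF assms(1) subgroup_conjugate[OF Hi]] by blast
  qed
  ultimately have "P = ?R"
    using assms(2) by (auto simp: maximal_parabolic_def)
  with f that show ?thesis by blast
qed

text \<open>
  The elements \<open>g\<close> and \<open>gh\<close> with \<open>h \<in> H\<^sub>i\<close> give the same conjugate of \<open>H\<^sub>i\<close>, so \<open>g\<close> may be
  replaced by a point of its coset near \<open>Q\<close>; translating that point by an element of \<open>Q\<close>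
  brings it near \<open>1\<close>.
\<close>

lemma maximal_parabolic_conjugate_near:
  assumes "BCP G X m H" "quasiconvex G X m H \<sigma> Q"
    and "maximal_parabolic G m H Q P" "infinite P"
  obtains q i z where "q \<in> Q" "i \<in> {1..m}" "z \<in> carrier G" "real (word_length G X z) \<le> \<sigma>"
    "conjugate G q P = Q \<inter> conjugate G z (H i)"
proof -
  have Q: "subgroup Q G" using assms(2) by (simp add: quasiconvex_def)
  interpret Q: subgroup Q G by fact
  obtain g i where g: "g \<in> carrier G" "i \<in> {1..m}" and P: "P = Q \<inter> conjugate G g (H i)"
    using maximal_parabolic_eq_Int[OF Q assms(3)] by blast
  interpret K: subgroup "H i" G using g(2) by (rule subgroup_H)
  obtain a p l h where a: "a \<in> P" and p: "geodesic_path G X m H p" "path_start G p = \<one>"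
    "path_end G p = a" and l: "l \<le> path_length p" "h \<in> H i" "path_vertex G p l = g \<otimes> h"
    using geodesic_meets_coset[OF assms(1) g(2,1) assms(4)] P by blast
  have "a \<in> Q" using a P by simp
  with assms(2) p l obtain w where w: "w \<in> Q" "real (word_dist G X (g \<otimes> h) w) \<le> \<sigma>"
    unfolding quasiconvex_def by (metis Q.one_closed)
  define z where "z = inv w \<otimes> (g \<otimes> h)"
  have c: "w \<in> carrier G" "h \<in> carrier G" "z \<in> carrier G"
    using w(1) l(2) g(1) by (auto simp: z_def)
  have "z = inv (inv (g \<otimes> h) \<otimes> w)"
    using c g(1) by (simp add: z_def inv_mult_group)
  then have "word_length G X z \<le> word_dist G X (g \<otimes> h) w"
    using word_length_inv_le[of "inv (g \<otimes> h) \<otimes> w"] c g(1) by (simp add: word_dist_def)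
  with w(2) have len: "real (word_length G X z) \<le> \<sigma>" by linarith
  have "conjugate G (inv w) P
      = conjugate G (inv w) Q \<inter> conjugate G (inv w) (conjugate G g (H i))"
    unfolding P using c g(1) Q.subset K.subset conjugate_subset_carrier
    by (intro conjugate_Int) auto
  also have "conjugate G (inv w) Q = Q"
    using Q w(1) by (simp add: conjugate_by_member)
  also have "conjugate G g (H i) = conjugate G g (conjugate G h (H i))"
    using conjugate_by_member[OF K.subgroup_axioms l(2)] by simp
  also have "conjugate G (inv w) \<dots> = conjugate G z (H i)"
    using c g(1) K.subset conjugate_subset_carrier
    by (simp add: conjugate_conjugate z_def m_assoc)
  finally show ?thesis
    using that[of "inv w" i z] w(1) g(2) c(3) len by simp
qed

lemma finite_near_intersections:
  "finite {Q \<inter> conjugate G z (H i) |i z.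
     i \<in> {1..m} \<and> z \<in> carrier G \<and> real (word_length G X z) \<le> \<sigma>}"
proof -
  have "{z \<in> carrier G. real (word_length G X z) \<le> \<sigma>}
      \<subseteq> {z \<in> carrier G. word_length G X z \<le> nat \<lfloor>\<sigma>\<rfloor>}"
    using le_nat_floor by blast
  then have "finite {z \<in> carrier G. real (word_length G X z) \<le> \<sigma>}"
    using finite_word_ball finite_subset by blast
  then have "finite ((\<lambda>(i, z). Q \<inter> conjugate G z (H i)) `
      ({1..m} \<times> {z \<in> carrier G. real (word_length G X z) \<le> \<sigma>}))"
    by blast
  then show ?thesis
    by (rule finite_subset[rotated]) auto
qed

end

section \<open>Finiteness up to conjugacy\<close>

theorem proposition1p5:
  fixes G :: "('a, 'b) monoid_scheme" and X :: "'a set"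
    and m :: nat and H :: "nat \<Rightarrow> 'a set"
    and Q :: "'a set" and \<sigma> :: real
  assumes "group G"
    and "finite X" and "X \<subseteq> carrier G" and "\<forall>x\<in>X. inv\<^bsub>G\<^esub> x \<in> X"
    and "generate G X = carrier G"
    and "\<forall>i\<in>{1..m}. subgroup (H i) G"
    and "relatively_hyperbolic G X m H"
    and "quasiconvex G X m H \<sigma> Q"
  shows "(\<forall>P. maximal_parabolic G m H Q P \<and> infinite P \<longrightarrow>
            (\<exists>q\<in>Q. conjugate G q P \<in>
               {Q \<inter> conjugate G z (H i) |i z.
                  i \<in> {1..m} \<and> z \<in> carrier G \<and> real (word_length G X z) \<le> \<sigma>})) \<and>
         finite ({P. maximal_parabolic G m H Q P \<and> infinite P} // conjugacy_rel G Q)"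
proof -
  interpret relative_cayley_graph G X m H
    using assms(1-6)
    by (intro relative_cayley_graph.intro relative_cayley_graph_axioms.intro) blast+
  let ?N = "{Q \<inter> conjugate G z (H i) |i z.
      i \<in> {1..m} \<and> z \<in> carrier G \<and> real (word_length G X z) \<le> \<sigma>}"
  let ?M = "{P. maximal_parabolic G m H Q P \<and> infinite P}"
  have BCP: "BCP G X m H" using assms(7) by (simp add: relatively_hyperbolic_def)
  have Q: "subgroup Q G" using assms(8) by (simp add: quasiconvex_def)
  have near: "\<exists>q\<in>Q. conjugate G q P \<in> ?N" if P: "P \<in> ?M" for P
  proof -
    obtain q i z where q: "q \<in> Q" and z: "i \<in> {1..m}" "z \<in> carrier G"
      "real (word_length G X z) \<le> \<sigma>" "conjugate G q P = Q \<inter> conjugate G z (H i)"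
      using maximal_parabolic_conjugate_near[OF BCP assms(8)] P by blast
    have "conjugate G q P \<in> ?N" unfolding z(4) using z(1-3) by blast
    with q show ?thesis by blast
  qed
  have "?M // conjugacy_rel G Q \<subseteq> (\<lambda>R. conjugacy_rel G Q `` {R}) ` ?N"
  proof
    fix C assume "C \<in> ?M // conjugacy_rel G Q"
    then obtain P where P: "P \<in> ?M" "C = conjugacy_rel G Q `` {P}"
      by (rule quotientE)
    then have "subgroup P G"
      by (simp add: maximal_parabolic_def parabolic_def)
    then have "P \<subseteq> carrier G"
      by (rule subgroup.subset)
    moreover obtain q where "q \<in> Q" "conjugate G q P \<in> ?N" using near[OF P(1)] by blast
    ultimately show "C \<in> (\<lambda>R. conjugacy_rel G Q `` {R}) ` ?N"
      using conjugacy_class_conjugate[OF Q] P(2) by blast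
  qed
  with finite_near_intersections have "finite (?M // conjugacy_rel G Q)"
    by (rule finite_surj)
  with near show ?thesis by blast
qed

end
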